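(* Let $\beta>0$ and $\alpha$ be integers and let $n\ge 0$. The $(n+1)\times(n+1)$ Hankel determinant $H_n^{(\beta,\alpha)}(x)=\det[a_{i+j}^{(\beta,\alpha)}(x)]_{0\le i,j\le n}$ is a polynomial in $x$ of degree at most $n$.
   Context: For $k\ge 0$, $a_k^{(\beta,\alpha)}(x)=\sum_{m=0}^{k}\binom{\beta k+\alpha-m}{k-m}x^m$, where for any real $z$ and integer $r\ge 0$, $\binom{z}{r}=\frac{z(z-1)\cdots(z-r+1)}{r!}$. The zero polynomial is regarded as satisfying any such degree bound. *)

theory Defs
  imports Complex_Main "HOL-Computational_Algebra.Polynomial" "Jordan_Normal_Form.Determinant"
begin

definition a_poly :: "int \<Rightarrow> int \<Rightarrow> nat \<Rightarrow> real poly" where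
  "a_poly \<beta> \<alpha> k =
     (\<Sum>m = 0..k. monom (real_of_int (\<beta> * int k + \<alpha> - int m) gchoose (k - m)) m)"

text \<open>The determinant is taken over the polynomial ring, so \<open>x\<close> is the indeterminate.\<close>

definition hankel_det :: "int \<Rightarrow> int \<Rightarrow> nat \<Rightarrow> real poly" where
  "hankel_det \<beta> \<alpha> n = det (mat (n + 1) (n + 1) (\<lambda>(i, j). a_poly \<beta> \<alpha> (i + j)))"

end

theory Submission
  imports Defs
begin

text \<open>
  Write \<open>p N k\<close> for the sum of the terms \<open>(N - m gchoose (k - m)) x^m\<close> over \<open>m \<le> k\<close>, so that
  \<open>a_k = p (\<beta> k + \<alpha>) k\<close>. Pascal's rule gives two relations modulo constants:
  \<open>p N (k + 1) \<equiv> (x - 1) p N k\<close> and \<open>p (N + 1) (k + 1) \<equiv> x p N k\<close>. Iterating them shows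
  that \<open>(x - 1)^(\<beta> - 1) a_(k+1) - x^\<beta> a_k\<close> has degree at most \<open>\<beta> - 1\<close>
  (lemma \<open>degree_gbinomial_poly_step\<close>), although its two terms have degree \<open>\<beta> + k\<close>.

  In the Hankel matrix, replace every row \<open>i \<ge> 1\<close> by \<open>(x - 1)^(\<beta> - 1)\<close> times itself minus
  \<open>x^\<beta>\<close> times row \<open>i - 1\<close>. This multiplies the determinant by \<open>(x - 1)^(n (\<beta> - 1))\<close>.
  Afterwards row \<open>0\<close> has entries of degree at most \<open>n\<close> and the other \<open>n\<close> rows have entries of
  degree at most \<open>\<beta> - 1\<close>, so the new determinant has degree at most \<open>n + n (\<beta> - 1)\<close>.
  Cancelling the factor leaves degree at most \<open>n\<close> (lemma \<open>degree_det_row_recurrence\<close>).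
\<close>

lemma degree_det_le_sum_row_degrees:
  fixes A :: "'a :: idom poly mat"
  assumes A: "A \<in> carrier_mat n n"
    and deg: "\<And>i j. i < n \<Longrightarrow> j < n \<Longrightarrow> degree (A $$ (i, j)) \<le> d i"
  shows "degree (det A) \<le> (\<Sum>i<n. d i)"
  unfolding det_def'[OF A]
proof (rule degree_sum_le)
  show "finite {p. p permutes {0..<n}}"
    by (simp add: finite_permutations)
next
  fix p assume "p \<in> {p. p permutes {0..<n}}"
  then have p: "p permutes {0..<n}" by simp
  have "degree (\<Prod>i = 0..<n. A $$ (i, p i)) \<le> (\<Sum>i = 0..<n. degree (A $$ (i, p i)))"
    using degree_prod_sum_le[of "{0..<n}" "\<lambda>i. A $$ (i, p i)"] by (simp add: o_def)
  also have "\<dots> \<le> (\<Sum>i = 0..<n. d i)"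
    using permutes_in_image[OF p] by (intro sum_mono deg) auto
  finally have "degree (\<Prod>i = 0..<n. A $$ (i, p i)) \<le> (\<Sum>i<n. d i)"
    by (simp add: lessThan_atLeast0)
  then show "degree (signof p * (\<Prod>i = 0..<n. A $$ (i, p i))) \<le> (\<Sum>i<n. d i)"
    by (auto simp: sign_def)
qed

text \<open>
  If consecutive rows are related by multipliers \<open>p\<close> and \<open>q\<close> up to an error of degree at most
  \<open>degree p\<close>, then the determinant obeys the degree bound of the first row alone.
\<close>

lemma degree_det_row_recurrence:
  fixes A :: "'a :: idom poly mat"
  assumes A: "A \<in> carrier_mat (Suc n) (Suc n)"
    and p: "p \<noteq> 0"
    and row0: "\<And>j. j \<le> n \<Longrightarrow> degree (A $$ (0, j)) \<le> d"
    and step: "\<And>i j. i < n \<Longrightarrow> j \<le> n \<Longrightarrow>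
      degree (p * A $$ (Suc i, j) - q * A $$ (i, j)) \<le> degree p"
  shows "degree (det A) \<le> d"
proof -
  \<comment> \<open>Left multiplication by \<open>L\<close> performs the row operations: row \<open>i + 1\<close> becomes
    \<open>p\<close> times itself minus \<open>q\<close> times row \<open>i\<close>.\<close>
  define L where "L = mat (Suc n) (Suc n)
    (\<lambda>(i, j). if i = j then if i = 0 then 1 else p else if i = Suc j then - q else 0)"
  have L: "L \<in> carrier_mat (Suc n) (Suc n)"
    by (simp add: L_def)
  have "det L = prod_list (diag_mat L)"
    by (rule det_lower_triangular[OF _ L]) (auto simp: L_def)
  also have "diag_mat L = 1 # map (\<lambda>i. p) [0..<n]"
    by (simp add: diag_mat_def L_def map_upt_Suc del: upt_Suc)
  also have "prod_list \<dots> = p ^ n"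
    by (simp add: map_replicate_const)
  finally have det_L: "det L = p ^ n" .
  have LA: "(L * A) $$ (i, j) = (\<Sum>k<Suc n. L $$ (i, k) * A $$ (k, j))"
    if "i < Suc n" "j < Suc n" for i j
    using that A L by (simp add: scalar_prod_def lessThan_atLeast0)
  have LA_0: "(L * A) $$ (0, j) = A $$ (0, j)" if "j \<le> n" for j
  proof -
    have "(L * A) $$ (0, j) = (\<Sum>k\<in>{0}. L $$ (0, k) * A $$ (k, j))"
      unfolding LA[OF zero_less_Suc le_imp_less_Suc[OF that]]
      by (rule sum.mono_neutral_right) (auto simp: L_def)
    then show ?thesis by (simp add: L_def)
  qed
  have LA_Suc: "(L * A) $$ (Suc i, j) = p * A $$ (Suc i, j) - q * A $$ (i, j)"
    if "i < n" "j \<le> n" for i j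
  proof -
    have "(L * A) $$ (Suc i, j) = (\<Sum>k\<in>{i, Suc i}. L $$ (Suc i, k) * A $$ (k, j))"
      unfolding LA[OF Suc_less_eq[THEN iffD2, OF that(1)] le_imp_less_Suc[OF that(2)]]
    proof (rule sum.mono_neutral_right)
      show "{i, Suc i} \<subseteq> {..<Suc n}"
        using that by auto
      show "\<forall>k\<in>{..<Suc n} - {i, Suc i}. L $$ (Suc i, k) * A $$ (k, j) = 0"
        using that by (simp add: L_def)
    qed simp
    then show ?thesis using that by (simp add: L_def)
  qed
  have deg_LA: "degree ((L * A) $$ (i, j)) \<le> (if i = 0 then d else degree p)"
    if "i < Suc n" "j < Suc n" for i j
    using that row0 step LA_0 LA_Suc by (cases i) auto
  have "degree (det (L * A)) \<le> (\<Sum>i<Suc n. if i = 0 then d else degree p)"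
    using mult_carrier_mat[OF L A] deg_LA by (rule degree_det_le_sum_row_degrees)
  also have "\<dots> = d + n * degree p"
    by (subst sum.lessThan_Suc_shift) simp
  finally have bound: "degree (p ^ n * det A) \<le> d + n * degree p"
    by (simp add: det_mult[OF L A] det_L)
  show ?thesis
  proof (cases "det A = 0")
    case False
    then have "degree (p ^ n * det A) = n * degree p + degree (det A)"
      using p by (simp add: degree_mult_eq degree_power_eq)
    with bound show ?thesis by simp
  qed simp
qed

text \<open>
  The polynomials of the Hankel matrix with the upper index \<open>N\<close> of the binomial coefficients
  independent of \<open>k\<close>. An arbitrary real \<open>N\<close> is allowed, since Pascal's rule shifts \<open>N\<close> alone.
\<close>

definition gbinomial_poly :: "real \<Rightarrow> nat \<Rightarrow> real poly" where
  "gbinomial_poly N k = (\<Sum>m\<le>k. monom (N - real m gchoose (k - m)) m)"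

lemma coeff_gbinomial_poly:
  "coeff (gbinomial_poly N k) j = (if j \<le> k then N - real j gchoose (k - j) else 0)"
  by (simp add: gbinomial_poly_def coeff_sum)

lemma degree_gbinomial_poly: "degree (gbinomial_poly N k) \<le> k"
  by (rule degree_le) (simp add: coeff_gbinomial_poly)

lemma gbinomial_poly_Suc_Suc:
  "gbinomial_poly (N + 1) (Suc k) = [:0, 1:] * gbinomial_poly N k + [:N + 1 gchoose Suc k:]"
  by (rule poly_eqI) (auto simp: coeff_gbinomial_poly coeff_pCons split: nat.split)

lemma gbinomial_poly_Suc:
  "gbinomial_poly N (Suc k) = [:-1, 1:] * gbinomial_poly N k + [:N + 1 gchoose Suc k:]"
proof (rule poly_eqI)
  fix j
  show "coeff (gbinomial_poly N (Suc k)) j =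
    coeff ([:-1, 1:] * gbinomial_poly N k + [:N + 1 gchoose Suc k:]) j"
  proof (cases j)
    case 0
    then show ?thesis
      by (simp add: coeff_gbinomial_poly gbinomial_Suc_Suc)
  next
    case (Suc i)
    consider "i < k" | "i = k" | "i > k" by linarith
    then show ?thesis
    proof cases
      case 1
      then obtain e where e: "k = Suc (i + e)"
        using less_imp_Suc_add by blast
      show ?thesis
        using gbinomial_Suc_Suc[of "N - real (Suc i)" e]
        by (simp add: Suc e coeff_gbinomial_poly algebra_simps Suc_diff_le)
    qed (simp_all add: Suc coeff_gbinomial_poly)
  qed
qed

lemma x_mult_gbinomial_poly:
  "[:0, 1:] * gbinomial_poly N k = [:-1, 1:] * gbinomial_poly (N + 1) k + [:N + 1 gchoose k:]"
proof -
  have "[:0, 1:] * gbinomial_poly N k + [:N + 1 gchoose Suc k:] =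
    [:-1, 1:] * gbinomial_poly (N + 1) k + [:N + 1 + 1 gchoose Suc k:]"
    by (rule trans[OF gbinomial_poly_Suc_Suc[symmetric] gbinomial_poly_Suc])
  moreover have "[:N + 1 + 1 gchoose Suc k:] = [:N + 1 gchoose k:] + [:N + 1 gchoose Suc k:]"
    using gbinomial_Suc_Suc[of "N + 1" k] by simp
  ultimately show ?thesis
    by (simp only: add.assoc[symmetric] add_right_cancel)
qed

text \<open>
  The cancellation behind the degree bound: both products have degree \<open>c + k + 1\<close>, but all
  coefficients above \<open>c\<close> agree.
\<close>

lemma degree_gbinomial_poly_step:
  "degree ([:-1, 1:] ^ c * gbinomial_poly (M + real c + 1) (Suc k)
    - [:0, 1:] ^ Suc c * gbinomial_poly M k) \<le> c"
proof (induction c)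
  case 0
  show ?case by (simp add: gbinomial_poly_Suc_Suc)
next
  case (Suc c)
  define D where "D = [:-1, 1:] ^ c * gbinomial_poly (M + real c + 1) (Suc k)
    - [:0, 1:] ^ Suc c * gbinomial_poly M k"
  define e where "e = (M + real c + 1 + 1 gchoose Suc k)"
  have ring: "y ^ Suc c * Q - x ^ Suc (Suc c) * R = x * (y ^ c * P - x ^ Suc c * R) - y ^ c * E"
    if "x * P = y * Q + E" for x y P Q R E :: "real poly"
  proof -
    have "y ^ Suc c * Q = y ^ c * (x * P - E)"
      unfolding that by simp
    then show ?thesis
      by (simp add: right_diff_distrib mult.left_commute)
  qed
  have "M + real (Suc c) + 1 = M + real c + 1 + 1"
    by simp
  then have "[:0, 1:] * gbinomial_poly (M + real c + 1) (Suc k) =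
      [:-1, 1:] * gbinomial_poly (M + real (Suc c) + 1) (Suc k) + [:e:]"
    by (simp only: x_mult_gbinomial_poly e_def)
  then have eq: "[:-1, 1:] ^ Suc c * gbinomial_poly (M + real (Suc c) + 1) (Suc k)
      - [:0, 1:] ^ Suc (Suc c) * gbinomial_poly M k = [:0, 1:] * D - [:-1, 1:] ^ c * [:e:]"
    unfolding D_def by (rule ring)
  have "degree ([:0, 1:] * D) \<le> Suc c"
    using degree_mult_le[of "[:0, 1:]" D] Suc.IH by (simp add: D_def)
  moreover have "degree ([:-1, 1:] ^ c * [:e:]) \<le> Suc c"
    using degree_mult_le[of "[:-1, 1:] ^ c" "[:e:]"] by (simp add: degree_linear_power)
  ultimately show ?case
    unfolding eq by (rule degree_diff_le)
qed

lemma a_poly_eq_gbinomial_poly: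
  "a_poly \<beta> \<alpha> k = gbinomial_poly (of_int \<beta> * real k + of_int \<alpha>) k"
  by (simp add: a_poly_def gbinomial_poly_def atMost_atLeast0)

lemma degree_a_poly_step:
  assumes "\<beta> > 0"
  shows "degree ([:-1, 1:] ^ nat (\<beta> - 1) * a_poly \<beta> \<alpha> (Suc k) - [:0, 1:] ^ nat \<beta> * a_poly \<beta> \<alpha> k)
    \<le> nat (\<beta> - 1)"
proof -
  have "real (nat (\<beta> - 1)) + 1 = of_int \<beta>" and "Suc (nat (\<beta> - 1)) = nat \<beta>"
    using assms by auto
  then show ?thesis
    using degree_gbinomial_poly_step[of "nat (\<beta> - 1)" "of_int \<beta> * real k + of_int \<alpha>" k]
    by (simp add: a_poly_eq_gbinomial_poly algebra_simps)
qed

theorem corollary10: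
  fixes \<beta> \<alpha> :: int and n :: nat
  assumes "\<beta> > 0"
  shows "degree (hankel_det \<beta> \<alpha> n) \<le> n"
  unfolding hankel_det_def
proof (rule degree_det_row_recurrence[where p = "[:-1, 1:] ^ nat (\<beta> - 1)" and q = "[:0, 1:] ^ nat \<beta>"])
  show "degree (mat (n + 1) (n + 1) (\<lambda>(i, j). a_poly \<beta> \<alpha> (i + j)) $$ (0, j)) \<le> n"
    if "j \<le> n" for j
    using that degree_gbinomial_poly[of _ j]
    by (auto simp: a_poly_eq_gbinomial_poly intro: order_trans)
next
  fix i j assume "i < n" "j \<le> n"
  then show "degree ([:-1, 1:] ^ nat (\<beta> - 1)
        * mat (n + 1) (n + 1) (\<lambda>(i, j). a_poly \<beta> \<alpha> (i + j)) $$ (Suc i, j)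
      - [:0, 1:] ^ nat \<beta> * mat (n + 1) (n + 1) (\<lambda>(i, j). a_poly \<beta> \<alpha> (i + j)) $$ (i, j))
    \<le> degree ([:-1, 1:] ^ nat (\<beta> - 1) :: real poly)"
    using degree_a_poly_step[OF assms, of \<alpha> "i + j"]
    by (simp add: degree_linear_power)
qed simp_all

end
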